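(* Let $A$ be a linear operator and suppose its adjoint $A^*$ satisfies $$\langle A^*v,v\rangle+C_1\|v\|_{L^2(\Omega)}^2\ge C_2\|v\|_{H^1(\Omega)}^2\qquad\forall v\in H^1(\Omega)$$ for constants $C_1\ge0$ and $C_2>0$. Let $\{u_h^j\}_{j=1}^n\subset V_h$ be the solutions of the forward scheme $$\frac{u_h^{j+1}-u_h^j}{\tau}+Au_h^{j+1}=f^{j+1}\ \text{ in } V_h',\quad j=0,\dots,n-1,\qquad u_h^0=u_{0,h},$$ with given initial condition $u_{0,h}\in L^2(\Omega)$, and let $\vec u_h^j\in\mathbb{R}^m$ be the coefficient vector of $u_h^j$. Let $$U=\begin{bmatrix}\tau^{1/2}\vec u_h^1&\tau^{1/2}\vec u_h^2&\cdots&\tau^{1/2}\vec u_h^n\end{bmatrix}:\mathbb{R}^n\to\mathbb{R}^m_M,$$ where the matrix $M$ is induced by the $L^2(\Omega)$ norm. Let $$\widetilde U=\begin{bmatrix}\tau^{1/2}\vec u_{h,r}^1&\tau^{1/2}\vec u_{h,r}^2&\cdots&\tau^{1/2}\vec u_{h,r}^n\end{bmatrix}$$ be the approximation of $U$ obtained by applying the iPOD with weight matrix $M$, and let $\epsilon$ satisfy $\|U-\widetilde U\|_{\mathrm{HS}}\le\epsilon$. Put $C_3=\frac{2C_1}{1-2C_1\tau}$ and $T=n\tau$. If $1-2C_1\tau>0$, then the gradient error $\xi$ satisfies $$\|\xi\|_{L^2(\Omega)}\le C_P\sqrt{\frac{e^{C_3T}}{C_2}}\;\epsilon .$$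
   Context: $\Omega$ is a bounded domain; $\|\cdot\|_{H^1(\Omega)}$ is the standard Sobolev norm of $H^1(\Omega)=W^{1,2}(\Omega)$. $C_P>0$ is a constant depending on $\Omega$ with $\|v\|_{L^2(\Omega)}\le C_P\|v\|_{H^1(\Omega)}$ for all $v\in H^1(\Omega)$. $V_h=\mathrm{span}\{\phi_1,\dots,\phi_m\}\subset H^1(\Omega)$ is a finite element space with basis $\{\phi_i\}$, $V_h'$ is its dual, and equations "in $V_h'$" are tested against all $v_h\in V_h$; $v_h=\sum_i a_i\phi_i$ has coefficient vector $\vec v_h=(a_1,\dots,a_m)^T$. $\langle\cdot,\cdot\rangle$ is the duality pairing (extending the $L^2$ inner product), $\tau>0$ is the time step, and $f^{j}$ are given source terms. Optimization problem: given observations $\hat u^j\in L^2(\Omega)$ and $\gamma$, minimize $J(u_{0,h})=\frac{\tau}{2}\sum_{j=1}^n\|\hat u^j-u_h^j\|_{L^2(\Omega)}^2+\frac{\gamma}{2}\|u_{0,h}\|_{L^2(\Omega)}^2$ subject to the forward scheme. Its gradient is $\nabla J(u_{0,h})=-u_h^{*0}+\gamma u_{0,h}$, where $u_h^{*j}\in V_h$ solves the backward adjoint scheme $$-\frac{u_h^{*j+1}-u_h^{*j}}{\tau}+A^*u_h^{*j}=\hat u^{j+1}-u_h^{j+1}\ \text{ in }V_h',\quad j=n-1,\dots,0,\qquad u_h^{*n}=0.$$ Gradient error: let $u_{h,r}^j\in V_h$ be the function with coefficient vector $\vec u_{h,r}^j$, and let $u_{h,r}^{*j}\in V_h$ solve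 the same backward scheme (with $u_{h,r}^{*n}=0$) with $u_h^{j+1}$ replaced by $u_{h,r}^{j+1}$. The computed gradient is $-u_{h,r}^{*0}+\gamma u_{0,h}$, and $\xi$ is the computed gradient minus the exact gradient, i.e. $\xi=u_h^{*0}-u_{h,r}^{*0}$. $\mathbb{R}^m_M$ is $\mathbb{R}^m$ with inner product $\vec y^TM\vec x$; here $M_{ij}=\int_\Omega\phi_j\phi_i$ (mass matrix), so $\|\vec v_h\|_{\mathbb{R}^m_M}=\|v_h\|_{L^2(\Omega)}$. $\|\cdot\|_{\mathrm{HS}}$ is the Hilbert-Schmidt norm of operators from $\mathbb{R}^n$ (standard inner product) to $\mathbb{R}^m_M$. iPOD (incremental proper orthogonal decomposition): the columns $\vec c^1,\dots,\vec c^n$ of the data matrix are processed one by one, starting with $\widetilde U^1=\vec c^1\ne 0$. Given $\widetilde U^j=V\Sigma W^T$ with $V^TMV=I$, $W^TW=I$, $\Sigma$ diagonal with positive decreasing entries, and thresholds $\mathtt{tol}_p,\mathtt{tol}_{sv}>0$, let $p=\|\vec c^{j+1}-VV^TM\vec c^{j+1}\|_{\mathbb{R}^m_M}$. If $p<\mathtt{tol}_p$ set $\widetilde U^{j+1}=\begin{bmatrix}\widetilde U^j&VV^TM\vec c^{j+1}\end{bmatrix}$; if $p\ge\mathtt{tol}_p$ and the smallest positive singular value of $\begin{bmatrix}\widetilde U^j&\vec c^{j+1}\end{bmatrix}:\mathbb{R}^{j+1}\to\mathbb{R}^m_M$ is $<\mathtt{tol}_{sv}$, let $\widetilde U^{j+1}$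 be that matrix with this singular value and its singular vectors removed from its SVD; otherwise $\widetilde U^{j+1}=\begin{bmatrix}\widetilde U^j&\vec c^{j+1}\end{bmatrix}$. The output is $\widetilde U=\widetilde U^n$. *)

theory Defs
  imports "HOL-Analysis.Analysis" "Jordan_Normal_Form.Matrix"
begin

unbundle no vec_syntax

section \<open>Sobolev space of order one\<close>

text \<open>
  Elements of \<open>L\<^sup>2(\<Omega>)\<close> and \<open>H\<^sup>1(\<Omega>)\<close> are represented by functions; two functions that agree
  almost everywhere on \<open>\<Omega>\<close> represent the same element.
\<close>

definition L2 :: "'a::euclidean_space set \<Rightarrow> ('a \<Rightarrow> real) set" where
  "L2 \<Omega> = {v. v \<in> borel_measurable (lebesgue_on \<Omega>) \<and> integrable (lebesgue_on \<Omega>) (\<lambda>x. (v x)\<^sup>2)}"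

definition L2_inner :: "'a::euclidean_space set \<Rightarrow> ('a \<Rightarrow> real) \<Rightarrow> ('a \<Rightarrow> real) \<Rightarrow> real" where
  "L2_inner \<Omega> v w = (LINT x|lebesgue_on \<Omega>. v x * w x)"

definition L2_norm :: "'a::euclidean_space set \<Rightarrow> ('a \<Rightarrow> real) \<Rightarrow> real" where
  "L2_norm \<Omega> v = sqrt (L2_inner \<Omega> v v)"

abbreviation partial :: "('a::euclidean_space \<Rightarrow> real) \<Rightarrow> 'a \<Rightarrow> 'a \<Rightarrow> real" where
  "partial f b \<equiv> \<lambda>x. frechet_derivative f (at x) b"

primrec Ck :: "nat \<Rightarrow> ('a::euclidean_space \<Rightarrow> real) \<Rightarrow> bool" where
  "Ck 0 f \<longleftrightarrow> continuous_on UNIV f"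
| "Ck (Suc k) f \<longleftrightarrow> f differentiable_on UNIV \<and> (\<forall>b\<in>Basis. Ck k (partial f b))"

definition test_functions :: "'a::euclidean_space set \<Rightarrow> ('a \<Rightarrow> real) set" where
  "test_functions \<Omega> =
     {\<psi>. (\<forall>k. Ck k \<psi>) \<and> compact (closure {x. \<psi> x \<noteq> 0}) \<and> closure {x. \<psi> x \<noteq> 0} \<subseteq> \<Omega>}"

definition is_weak_partial ::
    "'a::euclidean_space set \<Rightarrow> ('a \<Rightarrow> real) \<Rightarrow> 'a \<Rightarrow> ('a \<Rightarrow> real) \<Rightarrow> bool" where
  "is_weak_partial \<Omega> v b g \<longleftrightarrow>
     (\<forall>\<psi>\<in>test_functions \<Omega>. L2_inner \<Omega> v (partial \<psi> b) = - L2_inner \<Omega> g \<psi>)"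

definition H1 :: "'a::euclidean_space set \<Rightarrow> ('a \<Rightarrow> real) set" where
  "H1 \<Omega> = {v \<in> L2 \<Omega>. \<forall>b\<in>Basis. \<exists>g\<in>L2 \<Omega>. is_weak_partial \<Omega> v b g}"

text \<open>Weak partial derivatives are unique almost everywhere, so the choice below is immaterial.\<close>

definition weak_partial :: "'a::euclidean_space set \<Rightarrow> ('a \<Rightarrow> real) \<Rightarrow> 'a \<Rightarrow> 'a \<Rightarrow> real" where
  "weak_partial \<Omega> v b = (SOME g. g \<in> L2 \<Omega> \<and> is_weak_partial \<Omega> v b g)"

definition H1_norm :: "'a::euclidean_space set \<Rightarrow> ('a \<Rightarrow> real) \<Rightarrow> real" where
  "H1_norm \<Omega> v = sqrt ((L2_norm \<Omega> v)\<^sup>2 + (\<Sum>b\<in>Basis. (L2_norm \<Omega> (weak_partial \<Omega> v b))\<^sup>2))"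


section \<open>Functionals and operators\<close>

definition linear_functional_on :: "('a \<Rightarrow> real) set \<Rightarrow> (('a \<Rightarrow> real) \<Rightarrow> real) \<Rightarrow> bool" where
  "linear_functional_on V l \<longleftrightarrow>
     (\<forall>v\<in>V. \<forall>w\<in>V. \<forall>a b. l (\<lambda>x. a * v x + b * w x) = a * l v + b * l w)"

definition H1_dual :: "'a::euclidean_space set \<Rightarrow> (('a \<Rightarrow> real) \<Rightarrow> real) set" where
  "H1_dual \<Omega> =
     {l. linear_functional_on (H1 \<Omega>) l \<and> (\<exists>K. \<forall>v\<in>H1 \<Omega>. \<bar>l v\<bar> \<le> K * H1_norm \<Omega> v)}"

text \<open>
  An operator \<open>A\<close> from \<open>H\<^sup>1(\<Omega>)\<close> to its dual is represented by the pairing: \<open>A v w\<close> is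
  \<open>\<langle>A v, w\<rangle>\<close>. The second condition says that \<open>A\<close> is well defined on almost-everywhere classes.
\<close>

definition H1_operator ::
    "'a::euclidean_space set \<Rightarrow> (('a \<Rightarrow> real) \<Rightarrow> ('a \<Rightarrow> real) \<Rightarrow> real) \<Rightarrow> bool" where
  "H1_operator \<Omega> A \<longleftrightarrow>
     (\<forall>v\<in>H1 \<Omega>. A v \<in> H1_dual \<Omega>) \<and>
     (\<forall>v\<in>H1 \<Omega>. \<forall>v'\<in>H1 \<Omega>. (AE x in lebesgue_on \<Omega>. v x = v' x) \<longrightarrow> (\<forall>w\<in>H1 \<Omega>. A v w = A v' w)) \<and>
     (\<forall>w\<in>H1 \<Omega>. linear_functional_on (H1 \<Omega>) (\<lambda>v. A v w))"

definition is_H1_adjoint ::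
    "'a::euclidean_space set \<Rightarrow> (('a \<Rightarrow> real) \<Rightarrow> ('a \<Rightarrow> real) \<Rightarrow> real) \<Rightarrow>
      (('a \<Rightarrow> real) \<Rightarrow> ('a \<Rightarrow> real) \<Rightarrow> real) \<Rightarrow> bool" where
  "is_H1_adjoint \<Omega> A Astar \<longleftrightarrow>
     H1_operator \<Omega> Astar \<and> (\<forall>v\<in>H1 \<Omega>. \<forall>w\<in>H1 \<Omega>. Astar v w = A w v)"


section \<open>Finite element space and time stepping\<close>

text \<open>Basis functions and coefficients are indexed from 0, as entries of \<open>vec\<close> are.\<close>

definition fe_fun :: "(nat \<Rightarrow> 'a \<Rightarrow> real) \<Rightarrow> real vec \<Rightarrow> 'a \<Rightarrow> real" where
  "fe_fun \<phi> a = (\<lambda>x. \<Sum>i<dim_vec a. a $ i * \<phi> i x)"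

definition fe_space :: "(nat \<Rightarrow> 'a \<Rightarrow> real) \<Rightarrow> nat \<Rightarrow> ('a \<Rightarrow> real) set" where
  "fe_space \<phi> m = fe_fun \<phi> ` carrier_vec m"

definition fe_basis :: "'a::euclidean_space set \<Rightarrow> (nat \<Rightarrow> 'a \<Rightarrow> real) \<Rightarrow> nat \<Rightarrow> bool" where
  "fe_basis \<Omega> \<phi> m \<longleftrightarrow>
     (\<forall>i<m. \<phi> i \<in> H1 \<Omega>) \<and>
     (\<forall>a\<in>carrier_vec m. (AE x in lebesgue_on \<Omega>. fe_fun \<phi> a x = 0) \<longrightarrow> a = 0\<^sub>v m)"

definition mass_matrix :: "'a::euclidean_space set \<Rightarrow> (nat \<Rightarrow> 'a \<Rightarrow> real) \<Rightarrow> nat \<Rightarrow> real mat" where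
  "mass_matrix \<Omega> \<phi> m = mat m m (\<lambda>(i,j). L2_inner \<Omega> (\<phi> j) (\<phi> i))"

definition forward_scheme ::
    "'a::euclidean_space set \<Rightarrow> ('a \<Rightarrow> real) set \<Rightarrow> (('a \<Rightarrow> real) \<Rightarrow> ('a \<Rightarrow> real) \<Rightarrow> real) \<Rightarrow>
      (nat \<Rightarrow> ('a \<Rightarrow> real) \<Rightarrow> real) \<Rightarrow> real \<Rightarrow> nat \<Rightarrow> ('a \<Rightarrow> real) \<Rightarrow> (nat \<Rightarrow> 'a \<Rightarrow> real) \<Rightarrow> bool" where
  "forward_scheme \<Omega> V A f \<tau> n u0 u \<longleftrightarrow>
     u 0 = u0 \<and> (\<forall>j\<in>{1..n}. u j \<in> V) \<and>
     (\<forall>j<n. \<forall>w\<in>V.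
        L2_inner \<Omega> (\<lambda>x. (u (j + 1) x - u j x) / \<tau>) w + A (u (j + 1)) w = f (j + 1) w)"

definition backward_scheme ::
    "'a::euclidean_space set \<Rightarrow> ('a \<Rightarrow> real) set \<Rightarrow> (('a \<Rightarrow> real) \<Rightarrow> ('a \<Rightarrow> real) \<Rightarrow> real) \<Rightarrow>
      (nat \<Rightarrow> 'a \<Rightarrow> real) \<Rightarrow> (nat \<Rightarrow> 'a \<Rightarrow> real) \<Rightarrow> real \<Rightarrow> nat \<Rightarrow> (nat \<Rightarrow> 'a \<Rightarrow> real) \<Rightarrow> bool" where
  "backward_scheme \<Omega> V Astar uhat u \<tau> n ustar \<longleftrightarrow>
     ustar n = (\<lambda>x. 0) \<and> (\<forall>j\<le>n. ustar j \<in> V) \<and>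
     (\<forall>j<n. \<forall>w\<in>V.
        - L2_inner \<Omega> (\<lambda>x. (ustar (j + 1) x - ustar j x) / \<tau>) w + Astar (ustar j) w =
          L2_inner \<Omega> (\<lambda>x. uhat (j + 1) x - u (j + 1) x) w)"

text \<open>
  The \<open>L\<^sup>2\<close> gradient, at \<open>u0\<close>, of
  \<open>\<tau>/2 \<Sum>\<^sub>j \<parallel>uhat j - u j\<parallel>\<^sup>2 + \<gamma>/2 \<parallel>u0\<parallel>\<^sup>2\<close>, expressed through the adjoint state \<open>ustar\<close>.
\<close>

definition adjoint_gradient ::
    "real \<Rightarrow> ('a \<Rightarrow> real) \<Rightarrow> (nat \<Rightarrow> 'a \<Rightarrow> real) \<Rightarrow> 'a \<Rightarrow> real" where
  "adjoint_gradient \<gamma> u0 ustar = (\<lambda>x. - ustar 0 x + \<gamma> * u0 x)"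


section \<open>Weighted norms, singular value decomposition, incremental POD\<close>

definition weighted_norm :: "real mat \<Rightarrow> real vec \<Rightarrow> real" where
  "weighted_norm M x = sqrt (scalar_prod x (M *\<^sub>v x))"

definition hs_norm :: "real mat \<Rightarrow> real mat \<Rightarrow> real" where
  "hs_norm M X = sqrt (\<Sum>j<dim_col X. (weighted_norm M (X *\<^sub>v unit_vec (dim_col X) j))\<^sup>2)"

text \<open>Core singular value decomposition (positive singular values only) with respect to \<open>M\<close>.\<close>

definition core_svd :: "real mat \<Rightarrow> real mat \<Rightarrow> real mat \<Rightarrow> real mat \<Rightarrow> real mat \<Rightarrow> bool" where
  "core_svd M X V S W \<longleftrightarrow> (let r = dim_col V in
     V \<in> carrier_mat (dim_row X) r \<and> S \<in> carrier_mat r r \<and> W \<in> carrier_mat (dim_col X) r \<and>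
     X = V * S * transpose_mat W \<and>
     transpose_mat V * M * V = 1\<^sub>m r \<and> transpose_mat W * W = 1\<^sub>m r \<and>
     diagonal_mat S \<and> (\<forall>i<r. S $$ (i,i) > 0) \<and>
     (\<forall>i j. i \<le> j \<longrightarrow> j < r \<longrightarrow> S $$ (j,j) \<le> S $$ (i,i)))"

definition append_col :: "real mat \<Rightarrow> real vec \<Rightarrow> real mat" where
  "append_col X c = mat_of_cols (dim_row X) (cols X @ [c])"

definition first_cols :: "nat \<Rightarrow> real mat \<Rightarrow> real mat" where
  "first_cols k X = mat (dim_row X) k (\<lambda>(i,j). X $$ (i,j))"

definition weighted_proj :: "real mat \<Rightarrow> real mat \<Rightarrow> real vec \<Rightarrow> real vec" where
  "weighted_proj M V c = V *\<^sub>v (transpose_mat V *\<^sub>v (M *\<^sub>v c))"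

text \<open>
  Singular values are in decreasing order, so in a decomposition of rank \<open>k + 1\<close> the smallest one
  is the entry \<open>(k, k)\<close>. The step is a relation because singular vectors are not unique.
\<close>

inductive ipod_step ::
    "real mat \<Rightarrow> real \<Rightarrow> real \<Rightarrow> real mat \<Rightarrow> real vec \<Rightarrow> real mat \<Rightarrow> bool"
  for M :: "real mat" and tolp tolsv :: real and X :: "real mat" and c :: "real vec" where
  project: "ipod_step M tolp tolsv X c (append_col X (weighted_proj M V c))"
    if "core_svd M X V S W" "weighted_norm M (c - weighted_proj M V c) < tolp"
| truncate: "ipod_step M tolp tolsv X c
      (first_cols k V' * mat k k (\<lambda>(i,j). S' $$ (i,j)) * transpose_mat (first_cols k W'))"
    if "core_svd M X V S W" "weighted_norm M (c - weighted_proj M V c) \<ge> tolp"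
       "core_svd M (append_col X c) V' S' W'" "dim_col V' = k + 1" "S' $$ (k,k) < tolsv"
| append: "ipod_step M tolp tolsv X c (append_col X c)"
    if "core_svd M X V S W" "weighted_norm M (c - weighted_proj M V c) \<ge> tolp"
       "core_svd M (append_col X c) V' S' W'" "dim_col V' = k + 1" "S' $$ (k,k) \<ge> tolsv"

text \<open>\<open>ipod M tolp tolsv C j X\<close>: \<open>X\<close> is a possible result after processing the first \<open>j\<close> columns.\<close>

inductive ipod :: "real mat \<Rightarrow> real \<Rightarrow> real \<Rightarrow> real mat \<Rightarrow> nat \<Rightarrow> real mat \<Rightarrow> bool"
  for M :: "real mat" and tolp tolsv :: real and C :: "real mat" where
  start: "ipod M tolp tolsv C 1 (mat_of_cols (dim_row C) [col C 0])"
    if "dim_col C \<ge> 1" "col C 0 \<noteq> 0\<^sub>v (dim_row C)"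
| step: "ipod M tolp tolsv C (j + 1) Y"
    if "ipod M tolp tolsv C j X" "j < dim_col C" "ipod_step M tolp tolsv X (col C j) Y"

definition ipod_output :: "real mat \<Rightarrow> real \<Rightarrow> real \<Rightarrow> real mat \<Rightarrow> real mat \<Rightarrow> bool" where
  "ipod_output M tolp tolsv C X \<longleftrightarrow> ipod M tolp tolsv C (dim_col C) X"

definition snapshot_matrix :: "real \<Rightarrow> nat \<Rightarrow> nat \<Rightarrow> (nat \<Rightarrow> real vec) \<Rightarrow> real mat" where
  "snapshot_matrix \<tau> m n uvec = mat_of_cols m (map (\<lambda>j. \<tau> powr (1/2) \<cdot>\<^sub>v uvec j) [1..<n+1])"

end

theory Submission
  imports Defs
begin

text \<open>
  The gradient error is \<open>\<xi> = d 0\<close>, where \<open>d j = ustar j - urstar j\<close> is the difference of the two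
  adjoint states. The observations cancel in the difference of the two backward schemes, so
  \<open>d\<close> solves, with \<open>d n = 0\<close>, the adjoint scheme whose source is minus the state compression
  error \<open>e = u - ur\<close>:

  \<open>(d j - d (j + 1)) / \<tau> + A\<^sup>* (d j) = - e (j + 1)\<close>.

  The estimate is the energy method for this scheme. Testing with \<open>d j\<close>, bounding \<open>A\<^sup>*\<close> from
  below by the Garding inequality, and splitting \<open>(e (j + 1), d j)\<close> by Young's inequality with a
  weight for which the \<open>d j\<close> part is absorbed by the \<open>H\<^sup>1\<close> term, gives

  \<open>(1 - 2 C\<^sub>1 \<tau>) \<parallel>d j\<parallel>\<^sup>2 \<le> \<parallel>d (j + 1)\<parallel>\<^sup>2 + \<tau> C\<^sub>P\<^sup>2/(2 C\<^sub>2) \<parallel>e (j + 1)\<parallel>\<^sup>2\<close>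

  (lemma \<open>energy_step\<close>). Since \<open>1/(1 - 2 C\<^sub>1 \<tau>) = 1 + C\<^sub>3 \<tau> \<le> exp (C\<^sub>3 \<tau>)\<close>, going back from
  \<open>n\<close> to \<open>0\<close> costs at most the factor \<open>exp (C\<^sub>3 T)\<close> (lemma \<open>discrete_gronwall_backward\<close>).
  The accumulated source \<open>\<tau> \<Sum>\<^sub>j \<parallel>e j\<parallel>\<^sup>2\<close> is exactly the squared Hilbert-Schmidt norm of
  \<open>U - U'\<close>, because the mass matrix turns coefficient vectors into \<open>L\<^sup>2\<close> functions isometrically
  (lemma \<open>hs_norm_snapshot_diff\<close>). The bound obtained in this way is smaller than the claimed
  one by the factor \<open>sqrt 2\<close>.

  The error \<open>d j\<close> is a linear combination of basis functions, and the Garding inequality is only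
  available on \<open>H\<^sup>1\<close>; hence \<open>H\<^sup>1\<close> has to be shown to be a linear space
  (lemma \<open>H1_lincomb\<close>).
\<close>

section \<open>The spaces of square-integrable and of weakly differentiable functions\<close>

lemma L2_measurable: "v \<in> L2 \<Omega> \<Longrightarrow> v \<in> borel_measurable (lebesgue_on \<Omega>)"
  by (simp add: L2_def)

lemma L2_mult_integrable:
  assumes "v \<in> L2 \<Omega>" "w \<in> L2 \<Omega>"
  shows "integrable (lebesgue_on \<Omega>) (\<lambda>x. v x * w x)"
proof (rule Bochner_Integration.integrable_bound)
  show "integrable (lebesgue_on \<Omega>) (\<lambda>x. (v x)\<^sup>2 + (w x)\<^sup>2)"
    using assms by (auto simp: L2_def)
  show "(\<lambda>x. v x * w x) \<in> borel_measurable (lebesgue_on \<Omega>)"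
    using assms by (intro borel_measurable_times L2_measurable)
  have "\<bar>v x * w x\<bar> \<le> (v x)\<^sup>2 + (w x)\<^sup>2" for x
  proof -
    have "0 \<le> (\<bar>v x\<bar> - \<bar>w x\<bar>)\<^sup>2" "0 \<le> (v x)\<^sup>2 + (w x)\<^sup>2"
      by simp_all
    then show ?thesis
      unfolding power2_diff power2_abs abs_mult by linarith
  qed
  then show "AE x in lebesgue_on \<Omega>. norm (v x * w x) \<le> norm ((v x)\<^sup>2 + (w x)\<^sup>2)"
    by (simp del: abs_mult)
qed

lemma L2_lincomb:
  assumes "v \<in> L2 \<Omega>" "w \<in> L2 \<Omega>"
  shows "(\<lambda>x. a * v x + b * w x) \<in> L2 \<Omega>"
proof -
  have "integrable (lebesgue_on \<Omega>)
      (\<lambda>x. a\<^sup>2 * (v x * v x) + (2 * a * b) * (v x * w x) + b\<^sup>2 * (w x * w x))"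
    by (intro Bochner_Integration.integrable_add integrable_mult_right L2_mult_integrable assms)
  moreover have "(\<lambda>x. a\<^sup>2 * (v x * v x) + (2 * a * b) * (v x * w x) + b\<^sup>2 * (w x * w x)) =
      (\<lambda>x. (a * v x + b * w x)\<^sup>2)"
    by (simp add: fun_eq_iff power2_eq_square algebra_simps)
  moreover have "(\<lambda>x. a * v x + b * w x) \<in> borel_measurable (lebesgue_on \<Omega>)"
    using assms by (intro borel_measurable_add borel_measurable_times borel_measurable_const L2_measurable)
  ultimately show ?thesis by (simp add: L2_def)
qed

lemma L2_zero: "(\<lambda>x. 0) \<in> L2 \<Omega>"
  by (simp add: L2_def)

lemma L2_inner_commute: "L2_inner \<Omega> v w = L2_inner \<Omega> w v"
  by (simp add: L2_inner_def mult.commute)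

lemma L2_inner_lincomb_left:
  assumes "v \<in> L2 \<Omega>" "w \<in> L2 \<Omega>" "z \<in> L2 \<Omega>"
  shows "L2_inner \<Omega> (\<lambda>x. a * v x + b * w x) z = a * L2_inner \<Omega> v z + b * L2_inner \<Omega> w z"
proof -
  have "L2_inner \<Omega> (\<lambda>x. a * v x + b * w x) z =
      (LINT x|lebesgue_on \<Omega>. a * (v x * z x) + b * (w x * z x))"
    by (simp add: L2_inner_def algebra_simps)
  also have "\<dots> = a * L2_inner \<Omega> v z + b * L2_inner \<Omega> w z"
    unfolding L2_inner_def
    by (subst Bochner_Integration.integral_add)
       (intro integrable_mult_right L2_mult_integrable assms | simp)+
  finally show ?thesis .
qed

lemma L2_inner_lincomb_right:
  assumes "v \<in> L2 \<Omega>" "w \<in> L2 \<Omega>" "z \<in> L2 \<Omega>"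
  shows "L2_inner \<Omega> z (\<lambda>x. a * v x + b * w x) = a * L2_inner \<Omega> z v + b * L2_inner \<Omega> z w"
  using L2_inner_lincomb_left[OF assms] by (simp add: L2_inner_commute[of \<Omega> z])

lemma L2_inner_self: "L2_inner \<Omega> v v = (L2_norm \<Omega> v)\<^sup>2"
  unfolding L2_norm_def L2_inner_def by (simp add: integral_nonneg_AE)

lemma L2_norm_nonneg: "0 \<le> L2_norm \<Omega> v"
  unfolding L2_norm_def L2_inner_def by (simp add: integral_nonneg_AE)

text \<open>On a bounded domain, continuity up to the compact closure gives boundedness, and the measure
  is finite. Applied to test functions and their derivatives, this makes both integrals in
  \<open>is_weak_partial\<close> finite, hence additive in the function that is differentiated.\<close>

lemma continuous_imp_L2:
  fixes \<Omega> :: "'a::euclidean_space set"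
  assumes "open \<Omega>" "bounded \<Omega>" "continuous_on UNIV g"
  shows "g \<in> L2 \<Omega>"
proof -
  have lm: "\<Omega> \<in> lmeasurable"
    using assms by (simp add: lmeasurable_open)
  have fin: "finite_measure (lebesgue_on \<Omega>)"
    using lm by (rule finite_measure_lebesgue_on)
  have meas: "g \<in> borel_measurable (lebesgue_on \<Omega>)"
    using assms lm by (intro continuous_imp_measurable_on_sets_lebesgue)
      (auto intro: continuous_on_subset fmeasurableD)
  have "bounded (g ` closure \<Omega>)"
    using assms by (intro compact_imp_bounded compact_continuous_image)
      (auto simp: compact_closure intro: continuous_on_subset)
  then obtain B where B: "\<And>x. x \<in> closure \<Omega> \<Longrightarrow> \<bar>g x\<bar> \<le> B"
    by (auto simp: bounded_iff)
  have "(g x)\<^sup>2 \<le> B\<^sup>2" if "x \<in> \<Omega>" for x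
    using B[of x] that closure_subset[of \<Omega>]
    by (metis abs_ge_zero power2_abs power_mono subsetD)
  then have "integrable (lebesgue_on \<Omega>) (\<lambda>x. (g x)\<^sup>2)"
    using meas by (intro finite_measure.integrable_const_bound[OF fin, where B = "B\<^sup>2"])
      (auto intro!: AE_I2)
  with meas show ?thesis by (simp add: L2_def)
qed

lemma test_function_L2:
  assumes "open \<Omega>" "bounded \<Omega>" "\<psi> \<in> test_functions \<Omega>" "b \<in> Basis"
  shows "\<psi> \<in> L2 \<Omega>" "partial \<psi> b \<in> L2 \<Omega>"
proof -
  have "Ck 0 \<psi>" "Ck (Suc 0) \<psi>"
    using assms(3) by (auto simp: test_functions_def simp del: Ck.simps)
  then show "\<psi> \<in> L2 \<Omega>" "partial \<psi> b \<in> L2 \<Omega>"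
    using assms by (auto intro!: continuous_imp_L2)
qed

lemma H1_imp_L2: "v \<in> H1 \<Omega> \<Longrightarrow> v \<in> L2 \<Omega>"
  by (simp add: H1_def)

lemma H1_lincomb:
  assumes dom: "open \<Omega>" "bounded \<Omega>" and v: "v \<in> H1 \<Omega>" and w: "w \<in> H1 \<Omega>"
  shows "(\<lambda>x. a * v x + b * w x) \<in> H1 \<Omega>"
proof -
  have "\<exists>g\<in>L2 \<Omega>. is_weak_partial \<Omega> (\<lambda>x. a * v x + b * w x) i g" if i: "i \<in> Basis" for i
  proof -
    obtain g h where g: "g \<in> L2 \<Omega>" "is_weak_partial \<Omega> v i g"
      and h: "h \<in> L2 \<Omega>" "is_weak_partial \<Omega> w i h"
      using v w i unfolding H1_def by blast
    have "is_weak_partial \<Omega> (\<lambda>x. a * v x + b * w x) i (\<lambda>x. a * g x + b * h x)"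
      unfolding is_weak_partial_def
    proof
      fix \<psi> assume \<psi>: "\<psi> \<in> test_functions \<Omega>"
      note L2 = test_function_L2[OF dom \<psi> i]
      show "L2_inner \<Omega> (\<lambda>x. a * v x + b * w x) (partial \<psi> i) =
          - L2_inner \<Omega> (\<lambda>x. a * g x + b * h x) \<psi>"
        using g h \<psi> unfolding is_weak_partial_def
        by (subst (1 2) L2_inner_lincomb_left)
           (auto intro: L2 H1_imp_L2 v w)
    qed
    then show ?thesis
      using g(1) h(1) by (blast intro: L2_lincomb)
  qed
  then show ?thesis
    using v w by (auto simp: H1_def intro: L2_lincomb)
qed

lemma H1_zero: "(\<lambda>x. 0) \<in> H1 \<Omega>"
proof -
  have "is_weak_partial \<Omega> (\<lambda>x. 0) i (\<lambda>x. 0)" for i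
    by (simp add: is_weak_partial_def L2_inner_def)
  then show ?thesis
    by (auto simp: H1_def intro: L2_zero)
qed

section \<open>Finite element functions and the mass matrix\<close>

lemma sum_in_L2:
  fixes k :: nat
  assumes "\<And>i. i < k \<Longrightarrow> \<phi> i \<in> L2 \<Omega>"
  shows "(\<lambda>x. \<Sum>i<k. c i * \<phi> i x) \<in> L2 \<Omega>"
  using assms
proof (induction k)
  case (Suc k)
  then show ?case using L2_lincomb[of _ \<Omega> "\<phi> k" 1 "c k"] by simp
qed (simp add: L2_zero)

lemma L2_inner_sum_left:
  fixes k :: nat
  assumes "\<And>i. i < k \<Longrightarrow> \<phi> i \<in> L2 \<Omega>" "z \<in> L2 \<Omega>"
  shows "L2_inner \<Omega> (\<lambda>x. \<Sum>i<k. c i * \<phi> i x) z = (\<Sum>i<k. c i * L2_inner \<Omega> (\<phi> i) z)"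
  using assms
proof (induction k)
  case 0
  then show ?case by (simp add: L2_inner_def)
next
  case (Suc k)
  then show ?case
    using L2_inner_lincomb_left[OF sum_in_L2[of k \<phi> \<Omega> c], of "\<phi> k" z 1 "c k"] by simp
qed

lemma fe_fun_lincomb:
  assumes "a \<in> carrier_vec m" "b \<in> carrier_vec m"
  shows "fe_fun \<phi> (s \<cdot>\<^sub>v a + t \<cdot>\<^sub>v b) = (\<lambda>x. s * fe_fun \<phi> a x + t * fe_fun \<phi> b x)"
  using assms
  by (auto simp: fe_fun_def fun_eq_iff sum_distrib_left sum.distrib[symmetric] algebra_simps
      intro!: sum.cong)

lemma fe_fun_diff:
  assumes "a \<in> carrier_vec m" "b \<in> carrier_vec m"
  shows "fe_fun \<phi> (a - b) = (\<lambda>x. fe_fun \<phi> a x - fe_fun \<phi> b x)"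
  using assms
  by (auto simp: fe_fun_def fun_eq_iff sum_subtractf[symmetric] algebra_simps intro!: sum.cong)

lemma fe_space_lincomb:
  assumes "v \<in> fe_space \<phi> m" "w \<in> fe_space \<phi> m"
  shows "(\<lambda>x. s * v x + t * w x) \<in> fe_space \<phi> m"
proof -
  obtain a b where "a \<in> carrier_vec m" "b \<in> carrier_vec m" "v = fe_fun \<phi> a" "w = fe_fun \<phi> b"
    using assms by (auto simp: fe_space_def)
  then show ?thesis
    using fe_fun_lincomb[of a m b \<phi> s t, symmetric] by (auto simp: fe_space_def)
qed

lemma fe_space_subset_H1:
  assumes dom: "open \<Omega>" "bounded \<Omega>" and \<phi>: "\<And>i. i < m \<Longrightarrow> \<phi> i \<in> H1 \<Omega>"
  shows "fe_space \<phi> m \<subseteq> H1 \<Omega>"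
proof -
  have "(\<lambda>x. \<Sum>i<k. c i * \<phi> i x) \<in> H1 \<Omega>" if "k \<le> m" for k c
    using that
  proof (induction k)
    case (Suc k)
    then show ?case using H1_lincomb[OF dom, of _ "\<phi> k" 1 "c k"] \<phi>[of k] by simp
  qed (simp add: H1_zero)
  then show ?thesis
    by (auto simp: fe_space_def fe_fun_def)
qed

lemma mass_matrix_quadratic_form:
  assumes \<phi>: "\<And>i. i < m \<Longrightarrow> \<phi> i \<in> L2 \<Omega>" and a: "a \<in> carrier_vec m"
  shows "scalar_prod a (mass_matrix \<Omega> \<phi> m *\<^sub>v a) = (L2_norm \<Omega> (fe_fun \<phi> a))\<^sup>2"
proof -
  have L2: "fe_fun \<phi> a \<in> L2 \<Omega>"
    unfolding fe_fun_def using \<phi> a by (intro sum_in_L2) auto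
  have row: "L2_inner \<Omega> (\<phi> i) (fe_fun \<phi> a) = (mass_matrix \<Omega> \<phi> m *\<^sub>v a) $ i" if "i < m" for i
  proof -
    have "L2_inner \<Omega> (\<phi> i) (fe_fun \<phi> a) = (\<Sum>j<m. a $ j * L2_inner \<Omega> (\<phi> j) (\<phi> i))"
      using L2_inner_sum_left[of m \<phi> \<Omega> "\<phi> i" "\<lambda>j. a $ j"] \<phi> that a
      by (subst L2_inner_commute) (simp add: fe_fun_def)
    also have "\<dots> = (mass_matrix \<Omega> \<phi> m *\<^sub>v a) $ i"
      using that a by (auto simp: mass_matrix_def scalar_prod_def lessThan_atLeast0 mult.commute
          intro!: sum.cong)
    finally show ?thesis .
  qed
  have "(L2_norm \<Omega> (fe_fun \<phi> a))\<^sup>2 = (\<Sum>i<m. a $ i * L2_inner \<Omega> (\<phi> i) (fe_fun \<phi> a))"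
    using L2_inner_sum_left[of m \<phi> \<Omega> "fe_fun \<phi> a" "\<lambda>j. a $ j"] \<phi> a L2
    by (simp add: L2_inner_self[symmetric]) (simp add: fe_fun_def)
  also have "\<dots> = (\<Sum>i<m. a $ i * (mass_matrix \<Omega> \<phi> m *\<^sub>v a) $ i)"
    by (intro sum.cong) (auto simp: row)
  also have "\<dots> = scalar_prod a (mass_matrix \<Omega> \<phi> m *\<^sub>v a)"
    by (simp add: scalar_prod_def mass_matrix_def lessThan_atLeast0)
  finally show ?thesis by simp
qed

lemma weighted_norm_mass_matrix:
  assumes "\<And>i. i < m \<Longrightarrow> \<phi> i \<in> L2 \<Omega>" "a \<in> carrier_vec m"
  shows "weighted_norm (mass_matrix \<Omega> \<phi> m) a = L2_norm \<Omega> (fe_fun \<phi> a)"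
  using mass_matrix_quadratic_form[OF assms] by (simp add: weighted_norm_def L2_norm_nonneg)

text \<open>The factor \<open>\<tau> powr (1/2)\<close> in the snapshots makes the Hilbert-Schmidt norm the
  discrete \<open>L\<^sup>2\<close> norm in time and space.\<close>

lemma hs_norm_snapshot_diff:
  assumes \<tau>: "\<tau> > 0" and \<phi>: "\<And>i. i < m \<Longrightarrow> \<phi> i \<in> L2 \<Omega>"
    and a: "\<And>j. j \<in> {1..n} \<Longrightarrow> a j \<in> carrier_vec m"
    and b: "\<And>j. j \<in> {1..n} \<Longrightarrow> b j \<in> carrier_vec m"
  shows "(hs_norm (mass_matrix \<Omega> \<phi> m) (snapshot_matrix \<tau> m n a - snapshot_matrix \<tau> m n b))\<^sup>2 =
    \<tau> * (\<Sum>j<n. (L2_norm \<Omega> (fe_fun \<phi> (a (j + 1) - b (j + 1))))\<^sup>2)"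
proof -
  let ?M = "mass_matrix \<Omega> \<phi> m"
  let ?X = "snapshot_matrix \<tau> m n a - snapshot_matrix \<tau> m n b"
  have X: "?X \<in> carrier_mat m n"
    by (auto simp: snapshot_matrix_def)
  have column: "(weighted_norm ?M (?X *\<^sub>v unit_vec n j))\<^sup>2 =
      \<tau> * (L2_norm \<Omega> (fe_fun \<phi> (a (j + 1) - b (j + 1))))\<^sup>2" if j: "j < n" for j
  proof -
    let ?c = "a (j + 1) - b (j + 1)"
    have ab: "a (j + 1) \<in> carrier_vec m" "b (j + 1) \<in> carrier_vec m"
      using a b j by auto
    then have c: "?c \<in> carrier_vec m" by simp
    have "?X *\<^sub>v unit_vec n j = col ?X j"
    proof (rule eq_vecI)
      fix i assume "i < dim_vec (col ?X j)"
      then have i: "i < dim_row ?X" by simp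
      have "(?X *\<^sub>v unit_vec n j) $ i = Matrix.row ?X i $ j"
        using X i j by (simp add: scalar_prod_right_unit)
      also have "\<dots> = col ?X j $ i"
        using i j carrier_matD(2)[OF X] by (simp only: index_row(1) index_col)
      finally show "(?X *\<^sub>v unit_vec n j) $ i = col ?X j $ i" .
    qed simp
    also have "\<dots> = \<tau> powr (1/2) \<cdot>\<^sub>v ?c"
    proof
      fix i assume "i < dim_vec (\<tau> powr (1/2) \<cdot>\<^sub>v ?c)"
      then show "col ?X j $ i = (\<tau> powr (1/2) \<cdot>\<^sub>v ?c) $ i"
        using j ab by (simp add: snapshot_matrix_def mat_of_cols_def algebra_simps del: upt_Suc)
    next
      show "dim_vec (col ?X j) = dim_vec (\<tau> powr (1/2) \<cdot>\<^sub>v ?c)"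
        using ab by (simp add: snapshot_matrix_def)
    qed
    finally have "weighted_norm ?M (?X *\<^sub>v unit_vec n j) =
        L2_norm \<Omega> (fe_fun \<phi> (\<tau> powr (1/2) \<cdot>\<^sub>v ?c))"
      using weighted_norm_mass_matrix[of m \<phi> \<Omega> "\<tau> powr (1/2) \<cdot>\<^sub>v ?c"] \<phi> c by simp
    also have "fe_fun \<phi> (\<tau> powr (1/2) \<cdot>\<^sub>v ?c) = (\<lambda>x. sqrt \<tau> * fe_fun \<phi> ?c x)"
      using \<tau> ab by (auto simp: fe_fun_def fun_eq_iff powr_half_sqrt sum_distrib_left mult.assoc
          intro!: sum.cong)
    also have "(L2_norm \<Omega> (\<lambda>x. sqrt \<tau> * fe_fun \<phi> ?c x))\<^sup>2 = \<tau> * (L2_norm \<Omega> (fe_fun \<phi> ?c))\<^sup>2"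
    proof -
      have "(sqrt \<tau> * y) * (sqrt \<tau> * y) = \<tau> * (y * y)" for y
        using \<tau> by (simp add: algebra_simps)
      then show ?thesis
        by (simp only: L2_inner_self[symmetric] L2_inner_def integral_mult_right_zero)
    qed
    finally show ?thesis .
  qed
  have "(hs_norm ?M ?X)\<^sup>2 = (\<Sum>j<n. (weighted_norm ?M (?X *\<^sub>v unit_vec n j))\<^sup>2)"
    unfolding hs_norm_def carrier_matD(2)[OF X] by (simp add: sum_nonneg)
  also have "\<dots> = \<tau> * (\<Sum>j<n. (L2_norm \<Omega> (fe_fun \<phi> (a (j + 1) - b (j + 1))))\<^sup>2)"
    unfolding sum_distrib_left by (intro sum.cong refl column) simp
  finally show ?thesis .
qed

section \<open>The energy estimate for the adjoint scheme\<close>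

text \<open>The expansion of \<open>0 \<le> \<parallel>(k/2) v + w\<parallel>\<^sup>2\<close>, divided by \<open>k\<close>.\<close>

lemma L2_young:
  assumes "v \<in> L2 \<Omega>" "w \<in> L2 \<Omega>" "k > 0"
  shows "- L2_inner \<Omega> v w \<le> k / 4 * (L2_norm \<Omega> v)\<^sup>2 + (L2_norm \<Omega> w)\<^sup>2 / k"
proof -
  let ?z = "\<lambda>x. k / 2 * v x + 1 * w x"
  have "0 \<le> L2_inner \<Omega> ?z ?z"
    by (simp add: L2_inner_self)
  also have "\<dots> = k / 2 * (k / 2 * L2_inner \<Omega> v v + 1 * L2_inner \<Omega> v w) +
      1 * (k / 2 * L2_inner \<Omega> w v + 1 * L2_inner \<Omega> w w)"
    using assms(1,2) by (simp only: L2_inner_lincomb_left L2_inner_lincomb_right L2_lincomb)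
  also have "\<dots> = k * (k / 4 * (L2_norm \<Omega> v)\<^sup>2 + L2_inner \<Omega> v w + (L2_norm \<Omega> w)\<^sup>2 / k)"
    using assms(3) by (simp add: L2_inner_self L2_inner_commute[of \<Omega> w v] field_simps)
  finally show ?thesis
    using assms(3) by (simp add: zero_le_mult_iff)
qed

text \<open>One backward step, tested with the new value \<open>d\<close>; \<open>\<alpha>\<close> stands for \<open>\<langle>A\<^sup>*d, d\<rangle>\<close> and \<open>h\<close> for
  the \<open>H\<^sup>1\<close> norm of \<open>d\<close>. With the Young weight \<open>C\<^sub>P\<^sup>2/C\<^sub>2\<close> the part of the source
  term that contains \<open>d\<close> is at most \<open>C\<^sub>2 h\<^sup>2\<close>, so coercivity absorbs it completely.\<close>

lemma energy_step:
  assumes L2: "d \<in> L2 \<Omega>" "d' \<in> L2 \<Omega>" "e \<in> L2 \<Omega>"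
    and eq: "(L2_inner \<Omega> d d - L2_inner \<Omega> d' d) / \<tau> + \<alpha> = - L2_inner \<Omega> e d"
    and coercive: "\<alpha> + C\<^sub>1 * (L2_norm \<Omega> d)\<^sup>2 \<ge> C\<^sub>2 * h\<^sup>2"
    and embedding: "L2_norm \<Omega> d \<le> C\<^sub>P * h"
    and pos: "C\<^sub>P > 0" "C\<^sub>2 > 0" "\<tau> > 0"
  shows "(1 - 2 * C\<^sub>1 * \<tau>) * (L2_norm \<Omega> d)\<^sup>2
    \<le> (L2_norm \<Omega> d')\<^sup>2 + C\<^sub>P\<^sup>2 / (2 * C\<^sub>2) * (\<tau> * (L2_norm \<Omega> e)\<^sup>2)"
proof -
  let ?k = "C\<^sub>P\<^sup>2 / C\<^sub>2"
  have "(L2_norm \<Omega> d)\<^sup>2 \<le> C\<^sub>P\<^sup>2 * h\<^sup>2"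
    using power_mono[OF embedding L2_norm_nonneg, of 2] by (simp add: power_mult_distrib)
  then have absorb: "(L2_norm \<Omega> d)\<^sup>2 / ?k \<le> C\<^sub>2 * h\<^sup>2"
    using pos by (simp add: field_simps)
  have source: "- L2_inner \<Omega> e d \<le> ?k / 4 * (L2_norm \<Omega> e)\<^sup>2 + (L2_norm \<Omega> d)\<^sup>2 / ?k"
    using L2 pos by (intro L2_young) simp_all
  (* Young's inequality with weight 2 for -d' and d; this is what the implicit step needs, since
     d is the tested value and d' the known one. *)
  have "L2_inner \<Omega> d' d \<le> ((L2_norm \<Omega> d')\<^sup>2 + (L2_norm \<Omega> d)\<^sup>2) / 2"
    using L2_young[OF L2_lincomb[OF L2(2,2), of "-1" 0] L2(1), of 2]
      L2_inner_lincomb_left[OF L2(2,2,1), of "-1" 0]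
    by (simp add: L2_norm_def L2_inner_def)
  then have time: "((L2_norm \<Omega> d)\<^sup>2 - (L2_norm \<Omega> d')\<^sup>2) / 2
      \<le> L2_inner \<Omega> d d - L2_inner \<Omega> d' d"
    by (simp add: L2_inner_self)
  have "L2_inner \<Omega> d d - L2_inner \<Omega> d' d = \<tau> * (- L2_inner \<Omega> e d - \<alpha>)"
    using eq pos(3) by (simp add: field_simps)
  also have "\<dots> \<le> \<tau> * (?k / 4 * (L2_norm \<Omega> e)\<^sup>2 + C\<^sub>1 * (L2_norm \<Omega> d)\<^sup>2)"
    using source absorb coercive pos(3) by (intro mult_left_mono) linarith+
  finally have "((L2_norm \<Omega> d)\<^sup>2 - (L2_norm \<Omega> d')\<^sup>2) / 2
      \<le> \<tau> * (?k / 4 * (L2_norm \<Omega> e)\<^sup>2 + C\<^sub>1 * (L2_norm \<Omega> d)\<^sup>2)"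
    by (rule order_trans[OF time])
  then show ?thesis
    by (simp add: algebra_simps)
qed

lemma discrete_gronwall_backward:
  fixes y b :: "nat \<Rightarrow> real"
  assumes "q \<ge> 1" "\<And>j. b j \<ge> 0" "\<And>j. j < n \<Longrightarrow> y j \<le> q * (y (j + 1) + b j)"
  shows "y 0 \<le> q ^ n * (y n + (\<Sum>j<n. b j))"
  using assms(3)
proof (induction n)
  case (Suc n)
  have "y 0 \<le> q ^ n * (y n + (\<Sum>j<n. b j))"
    using Suc by simp
  also have "y n + (\<Sum>j<n. b j) \<le> q * (y (Suc n) + b n) + q * (\<Sum>j<n. b j)"
    using Suc.prems[of n] mult_right_mono[OF assms(1), of "\<Sum>j<n. b j"] assms(2)
    by (intro add_mono) (simp_all add: sum_nonneg)
  finally show ?case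
    using assms(1) by (simp add: algebra_simps)
qed simp

text \<open>The source terms enter only through their difference, so the observations drop out.
  The right-hand sides have to be square-integrable for the \<open>L\<^sup>2\<close> products to be
  additive.\<close>

lemma backward_scheme_diff:
  assumes V: "V \<subseteq> H1 \<Omega>" "\<And>v w s t. v \<in> V \<Longrightarrow> w \<in> V \<Longrightarrow> (\<lambda>x. s * v x + t * w x) \<in> V"
    and Astar: "H1_operator \<Omega> Astar"
    and uhat: "\<And>j. j \<in> {1..n} \<Longrightarrow> uhat j \<in> L2 \<Omega>"
    and u: "\<And>j. j \<in> {1..n} \<Longrightarrow> u j \<in> L2 \<Omega>"
    and ur: "\<And>j. j \<in> {1..n} \<Longrightarrow> ur j \<in> L2 \<Omega>"
    and p: "backward_scheme \<Omega> V Astar uhat u \<tau> n p"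
    and q: "backward_scheme \<Omega> V Astar uhat ur \<tau> n q"
    and j: "j < n" and w: "w \<in> V"
  defines "d \<equiv> \<lambda>j x. p j x - q j x"
  shows "(L2_inner \<Omega> (d j) w - L2_inner \<Omega> (d (j + 1)) w) / \<tau> + Astar (d j) w =
    - L2_inner \<Omega> (\<lambda>x. u (j + 1) x - ur (j + 1) x) w"
proof -
  have sub: "L2_inner \<Omega> (\<lambda>x. v x - z x) w = L2_inner \<Omega> v w - L2_inner \<Omega> z w"
    if "v \<in> L2 \<Omega>" "z \<in> L2 \<Omega>" for v z
    using L2_inner_lincomb_left[OF that, of w 1 "-1"] w V by (auto simp: H1_imp_L2)
  have quot: "L2_inner \<Omega> (\<lambda>x. (v x - z x) / \<tau>) w = (L2_inner \<Omega> v w - L2_inner \<Omega> z w) / \<tau>"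
    if "v \<in> L2 \<Omega>" "z \<in> L2 \<Omega>" for v z
    using sub[OF that] by (simp add: L2_inner_def)
  have mem: "p j \<in> V" "q j \<in> V" "p (j + 1) \<in> V" "q (j + 1) \<in> V"
    using p q j by (auto simp: backward_scheme_def)
  then have H1: "p j \<in> H1 \<Omega>" "q j \<in> H1 \<Omega>" and wH: "w \<in> H1 \<Omega>"
    using V w by auto
  have L2: "p j \<in> L2 \<Omega>" "q j \<in> L2 \<Omega>" "p (j + 1) \<in> L2 \<Omega>" "q (j + 1) \<in> L2 \<Omega>"
    using mem V by (auto simp: H1_imp_L2)
  have "linear_functional_on (H1 \<Omega>) (\<lambda>v. Astar v w)"
    using Astar wH by (simp add: H1_operator_def)
  from this[unfolded linear_functional_on_def, rule_format, OF H1, of 1 "-1"]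
  have A: "Astar (d j) w = Astar (p j) w - Astar (q j) w"
    by (simp add: d_def)
  have "- L2_inner \<Omega> (\<lambda>x. (p (j + 1) x - p j x) / \<tau>) w + Astar (p j) w =
      L2_inner \<Omega> (\<lambda>x. uhat (j + 1) x - u (j + 1) x) w"
    and "- L2_inner \<Omega> (\<lambda>x. (q (j + 1) x - q j x) / \<tau>) w + Astar (q j) w =
      L2_inner \<Omega> (\<lambda>x. uhat (j + 1) x - ur (j + 1) x) w"
    using p q j w by (auto simp: backward_scheme_def)
  then have
      "- ((L2_inner \<Omega> (p (j + 1)) w - L2_inner \<Omega> (p j) w) / \<tau>) + Astar (p j) w =
        L2_inner \<Omega> (uhat (j + 1)) w - L2_inner \<Omega> (u (j + 1)) w"
    and "- ((L2_inner \<Omega> (q (j + 1)) w - L2_inner \<Omega> (q j) w) / \<tau>) + Astar (q j) w =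
        L2_inner \<Omega> (uhat (j + 1)) w - L2_inner \<Omega> (ur (j + 1)) w"
    using L2 uhat[of "j + 1"] u[of "j + 1"] ur[of "j + 1"] j by (simp_all add: sub quot)
  moreover have "L2_inner \<Omega> (\<lambda>x. u (j + 1) x - ur (j + 1) x) w =
      L2_inner \<Omega> (u (j + 1)) w - L2_inner \<Omega> (ur (j + 1)) w"
    using u[of "j + 1"] ur[of "j + 1"] j by (simp add: sub)
  ultimately show ?thesis
    using L2 unfolding A by (simp add: sub d_def diff_divide_distrib)
qed

theorem theorem7:
  fixes \<Omega> :: "'a::euclidean_space set"
    and \<phi> :: "nat \<Rightarrow> 'a \<Rightarrow> real" and m n :: nat
    and A Astar :: "('a \<Rightarrow> real) \<Rightarrow> ('a \<Rightarrow> real) \<Rightarrow> real"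
    and f :: "nat \<Rightarrow> ('a \<Rightarrow> real) \<Rightarrow> real"
    and \<tau> \<gamma> C\<^sub>P C\<^sub>1 C\<^sub>2 C\<^sub>3 T \<epsilon> tolp tolsv :: real
    and u0 :: "'a \<Rightarrow> real" and uhat u ustar ur urstar :: "nat \<Rightarrow> 'a \<Rightarrow> real"
    and uvec urvec :: "nat \<Rightarrow> real vec"
    and M U U' :: "real mat" and \<xi> :: "'a \<Rightarrow> real"
  assumes domain: "open \<Omega>" "connected \<Omega>" "\<Omega> \<noteq> {}" "bounded \<Omega>"
    and C\<^sub>P: "C\<^sub>P > 0" "\<And>v. v \<in> H1 \<Omega> \<Longrightarrow> L2_norm \<Omega> v \<le> C\<^sub>P * H1_norm \<Omega> v"
    and basis: "fe_basis \<Omega> \<phi> m"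
    and A: "H1_operator \<Omega> A" "is_H1_adjoint \<Omega> A Astar"
    and C\<^sub>1: "C\<^sub>1 \<ge> 0" and C\<^sub>2: "C\<^sub>2 > 0"
    and garding: "\<And>v. v \<in> H1 \<Omega> \<Longrightarrow>
          Astar v v + C\<^sub>1 * (L2_norm \<Omega> v)\<^sup>2 \<ge> C\<^sub>2 * (H1_norm \<Omega> v)\<^sup>2"
    and \<tau>: "\<tau> > 0"
    and f: "\<And>j. j \<in> {1..n} \<Longrightarrow> linear_functional_on (fe_space \<phi> m) (f j)"
    and u0: "u0 \<in> L2 \<Omega>"
    and uhat: "\<And>j. j \<in> {1..n} \<Longrightarrow> uhat j \<in> L2 \<Omega>"
    and forward: "forward_scheme \<Omega> (fe_space \<phi> m) A f \<tau> n u0 u"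
    and coeffs: "\<And>j. j \<in> {1..n} \<Longrightarrow> uvec j \<in> carrier_vec m \<and> u j = fe_fun \<phi> (uvec j)"
    and M: "M = mass_matrix \<Omega> \<phi> m"
    and U: "U = snapshot_matrix \<tau> m n uvec"
    and tol: "tolp > 0" "tolsv > 0"
    and ipod: "ipod_output M tolp tolsv U U'"
    and U': "U' = snapshot_matrix \<tau> m n urvec"
    and coeffs_r: "\<And>j. j \<in> {1..n} \<Longrightarrow> urvec j \<in> carrier_vec m \<and> ur j = fe_fun \<phi> (urvec j)"
    and \<epsilon>: "hs_norm M (U - U') \<le> \<epsilon>"
    and backward: "backward_scheme \<Omega> (fe_space \<phi> m) Astar uhat u \<tau> n ustar"
    and backward_r: "backward_scheme \<Omega> (fe_space \<phi> m) Astar uhat ur \<tau> n urstar"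
    and \<xi>: "\<xi> = (\<lambda>x. adjoint_gradient \<gamma> u0 urstar x - adjoint_gradient \<gamma> u0 ustar x)"
    and C\<^sub>3: "C\<^sub>3 = 2 * C\<^sub>1 / (1 - 2 * C\<^sub>1 * \<tau>)"
    and T: "T = real n * \<tau>"
    and small: "1 - 2 * C\<^sub>1 * \<tau> > 0"
  shows "L2_norm \<Omega> \<xi> \<le> C\<^sub>P * sqrt (exp (C\<^sub>3 * T) / C\<^sub>2) * \<epsilon>"
  proof -
  let ?V = "fe_space \<phi> m"
  let ?K = "C\<^sub>P\<^sup>2 / (2 * C\<^sub>2)"
  let ?q = "1 / (1 - 2 * C\<^sub>1 * \<tau>)"
  define d where "d = (\<lambda>j x. ustar j x - urstar j x)"
  define e where "e = (\<lambda>j x. u j x - ur j x)"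
  have \<phi>: "\<phi> i \<in> H1 \<Omega>" if "i < m" for i
    using basis that by (simp add: fe_basis_def)
  have VH: "?V \<subseteq> H1 \<Omega>"
    using domain \<phi> by (intro fe_space_subset_H1)
  have L2: "v \<in> L2 \<Omega>" if "v \<in> ?V" for v
    using VH that by (auto intro: H1_imp_L2)
  have uV: "u j \<in> ?V" "ur j \<in> ?V" if "j \<in> {1..n}" for j
    using coeffs[OF that] coeffs_r[OF that] by (auto simp: fe_space_def)
  have dV: "d j \<in> ?V" if "j \<le> n" for j
    using backward backward_r that fe_space_lincomb[of "ustar j" \<phi> m "urstar j" 1 "-1"]
    by (simp add: backward_scheme_def d_def)
  have eL2: "e j \<in> L2 \<Omega>" if "j \<in> {1..n}" for j
    using L2_lincomb[OF L2 L2, OF uV, OF that that, of 1 "-1"] by (simp add: e_def)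
  have "H1_operator \<Omega> Astar"
    using A(2) by (simp add: is_H1_adjoint_def)
  from backward_scheme_diff[OF VH fe_space_lincomb this uhat L2 L2 backward backward_r, OF _ _ _ uV]
  have scheme: "(L2_inner \<Omega> (d j) w - L2_inner \<Omega> (d (j + 1)) w) / \<tau> + Astar (d j) w =
      - L2_inner \<Omega> (e (j + 1)) w" if "j < n" "w \<in> ?V" for j w
    using that unfolding d_def e_def by blast
  have step: "(L2_norm \<Omega> (d j))\<^sup>2
      \<le> ?q * ((L2_norm \<Omega> (d (j + 1)))\<^sup>2 + ?K * (\<tau> * (L2_norm \<Omega> (e (j + 1)))\<^sup>2))"
    if j: "j < n" for j
  proof -
    have dj: "d j \<in> ?V" "d (j + 1) \<in> ?V" "d j \<in> H1 \<Omega>"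
      using dV[of j] dV[of "j + 1"] j VH by auto
    have "(1 - 2 * C\<^sub>1 * \<tau>) * (L2_norm \<Omega> (d j))\<^sup>2
        \<le> (L2_norm \<Omega> (d (j + 1)))\<^sup>2 + ?K * (\<tau> * (L2_norm \<Omega> (e (j + 1)))\<^sup>2)"
      using j dj C\<^sub>P C\<^sub>2 \<tau>
      by (intro energy_step[where h = "H1_norm \<Omega> (d j)", OF _ _ _ scheme garding])
         (auto intro: L2 eL2)
    then show ?thesis
      using small by (simp add: field_simps)
  qed
  have q1: "?q \<ge> 1"
    using small C\<^sub>1 \<tau> by (simp add: field_simps)
  have "(L2_norm \<Omega> (d 0))\<^sup>2 \<le> ?q ^ n *
      ((L2_norm \<Omega> (d n))\<^sup>2 + (\<Sum>j<n. ?K * (\<tau> * (L2_norm \<Omega> (e (j + 1)))\<^sup>2)))"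
    using C\<^sub>2 \<tau> step
    by (intro discrete_gronwall_backward[OF q1, where y = "\<lambda>j. (L2_norm \<Omega> (d j))\<^sup>2"]) auto
  also have "L2_norm \<Omega> (d n) = 0"
    using backward backward_r by (simp add: backward_scheme_def d_def L2_norm_def L2_inner_def)
  also have "(\<Sum>j<n. ?K * (\<tau> * (L2_norm \<Omega> (e (j + 1)))\<^sup>2)) = ?K * (hs_norm M (U - U'))\<^sup>2"
  proof -
    have "(\<Sum>j<n. (L2_norm \<Omega> (e (j + 1)))\<^sup>2) =
        (\<Sum>j<n. (L2_norm \<Omega> (fe_fun \<phi> (uvec (j + 1) - urvec (j + 1))))\<^sup>2)"
      using coeffs coeffs_r by (intro sum.cong refl) (simp add: e_def fe_fun_diff[of _ m])
    moreover have "(hs_norm M (U - U'))\<^sup>2 =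
        \<tau> * (\<Sum>j<n. (L2_norm \<Omega> (fe_fun \<phi> (uvec (j + 1) - urvec (j + 1))))\<^sup>2)"
      unfolding M U U' using \<tau> \<phi> coeffs coeffs_r
      by (intro hs_norm_snapshot_diff) (auto intro: H1_imp_L2)
    ultimately show ?thesis
      by (simp only: sum_distrib_left[symmetric])
  qed
  finally have bound: "(L2_norm \<Omega> (d 0))\<^sup>2 \<le> ?q ^ n * (?K * (hs_norm M (U - U'))\<^sup>2)"
    by simp
  have hs: "0 \<le> hs_norm M (U - U')"
    by (simp add: hs_norm_def sum_nonneg)
  then have hs2: "(hs_norm M (U - U'))\<^sup>2 \<le> \<epsilon>\<^sup>2"
    using \<epsilon> by (intro power_mono)
  have "?q = 1 + C\<^sub>3 * \<tau>"
    using small by (simp add: C\<^sub>3 field_simps)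
  then have "?q ^ n \<le> exp (C\<^sub>3 * \<tau>) ^ n"
    using q1 by (intro power_mono) (simp_all add: exp_ge_add_one_self)
  also have "\<dots> = exp (C\<^sub>3 * T)"
    by (simp add: T exp_of_nat_mult[symmetric] algebra_simps)
  finally have growth: "?q ^ n \<le> exp (C\<^sub>3 * T)" .
  have "?K * (hs_norm M (U - U'))\<^sup>2 \<le> C\<^sub>P\<^sup>2 / C\<^sub>2 * \<epsilon>\<^sup>2"
    using hs2 C\<^sub>2 by (intro mult_mono) (simp_all add: field_simps)
  then have "?q ^ n * (?K * (hs_norm M (U - U'))\<^sup>2) \<le> exp (C\<^sub>3 * T) * (C\<^sub>P\<^sup>2 / C\<^sub>2 * \<epsilon>\<^sup>2)"
    by (rule mult_mono[OF growth]) (use C\<^sub>2 in simp_all)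
  also have "\<dots> = (C\<^sub>P * sqrt (exp (C\<^sub>3 * T) / C\<^sub>2) * \<epsilon>)\<^sup>2"
    using C\<^sub>2 by (simp add: power_mult_distrib)
  finally have "(L2_norm \<Omega> (d 0))\<^sup>2 \<le> (C\<^sub>P * sqrt (exp (C\<^sub>3 * T) / C\<^sub>2) * \<epsilon>)\<^sup>2"
    using bound by linarith
  moreover have "0 \<le> C\<^sub>P * sqrt (exp (C\<^sub>3 * T) / C\<^sub>2) * \<epsilon>"
    using hs \<epsilon> C\<^sub>P(1) C\<^sub>2 by simp
  ultimately have "L2_norm \<Omega> (d 0) \<le> C\<^sub>P * sqrt (exp (C\<^sub>3 * T) / C\<^sub>2) * \<epsilon>"
    by (rule power2_le_imp_le)
  moreover have "\<xi> = d 0"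
    by (simp add: \<xi> adjoint_gradient_def d_def fun_eq_iff)
  ultimately show ?thesis
    by simp
qed

end
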